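(* Let $f\ge2$. Any target function $\phi$ with $0\le\alpha(\phi)<1$ is not an algorithm for the fault-tolerant $(n,f)$-convergence problem to $f$ points (FC($f$)-PO); equivalently, any (non-empty) set $\Phi$ of target functions with $0\le\alpha(\Phi)<1$ is not compatible with respect to FC($f$)-PO.
   Context: Robot model. Robots $r_1,\dots,r_n$ are points in the plane $\mathbb{R}^2$, which carries a fixed right-handed global coordinate system $Z_0$. Time is discrete, $t=0,1,2,\dots$; $\mathbf{x}_t(r_i)$ is the position of $r_i$ at time $t$ in $Z_0$, and the configuration at $t$ is the multiset $P_t=\{\mathbf{x}_t(r_i):1\le i\le n\}$. Robot $r_i$ has a local coordinate system $Z_i$, right-handed, with its own unit length and axis directions (arbitrary, fixed over time), whose origin is always the current position of $r_i$; $\gamma_i$ denotes the coordinate transformation from $Z_i$ to $Z_0$ (an orientation-preserving similarity with $\gamma_i((0,0))=\mathbf{x}_t(r_i)$ at time $t$). A target function $\phi$ assigns to every multiset $P$ of $n$ points of $\mathbb{R}^2$ (for every $n\ge1$) an element of $\mathbb{R}^2\cup\{\bot\}$, with $\phi(P)=\bot$ if and only if $(0,0)\notin P$. Each robot $r_i$ is assigned a target function $\phi_i$. The scheduler is semi-synchronous: at each time $t$ an arbitrary subset of robots is activated; if a non-crashed $r_i$ is activated at $t$ then $\mathbf{x}_{t+1}(r_i)=\gamma_i(\phi_i(\gamma_i^{-1}(P_t)))$, otherwise $\mathbf{x}_{t+1}(r_i)=\mathbf{x}_t(r_i)$. The schedule is fair: every robot is activated infinitely often. A faulty robot may crash at an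 arbitrary time (possibly already at time $0$), after which it never moves again; crashed robots cannot be distinguished from other robots. The sequence $P_0,P_1,\dots$ is an execution. Scale. $CH(P)$ is the convex hull of $P$, $g(P)=\frac1n\sum_{\mathbf{x}\in P}\mathbf{x}$ (with multiplicity), and $d*CH(P)=\{d\mathbf{x}+(1-d)g(P):\mathbf{x}\in CH(P)\}$ for $d\ge0$. $\alpha(\phi,P)$ is the smallest $d\ge 0$ with $\phi(P)\in d*CH(P)$ (and $0$ if $\phi(P)=\bot$; $\infty$ if there is no such $d$). $\alpha(\phi)=\sup_P\alpha(\phi,P)$ and $\alpha(\Phi)=\sup_{\phi\in\Phi}\alpha(\phi)$. Compatibility. $\Phi$ is compatible with respect to FC($f$)-PO if, for every number $n\ge f+1$ of robots, every assignment of target functions from $\Phi$ to the robots (different robots may get different ones), every choice of local coordinate systems, every initial configuration, every fair schedule and every pattern of crashes in which at most $f$ robots are faulty, all robots (including faulty ones) converge to at most $f$ points, i.e., there is a set of at most $f$ points such that each robot converges to one of them as $t\to\infty$. A target function $\phi$ is an algorithm for FC($f$)-PO if $\{\phi\}$ is compatible with respect to FC($f$)-PO. *)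

theory Defs
  imports "HOL-Analysis.Analysis" "HOL-Library.Multiset" "HOL-Library.Extended_Nat"
begin

type_synonym point = "real^2"
type_synonym config = "point multiset"

text \<open>The value \<^term>\<open>None\<close> stands for the undefined target. Target functions are only meant to be
  applied to nonempty multisets, so their value at \<^term>\<open>{#}\<close> is left unconstrained and
  is ignored below.\<close>

type_synonym target = "config \<Rightarrow> point option"

definition target_function :: "target \<Rightarrow> bool" where
  "target_function \<phi> \<longleftrightarrow> (\<forall>P. P \<noteq> {#} \<longrightarrow> (\<phi> P = None \<longleftrightarrow> 0 \<notin># P))"


subsection \<open>Scale\<close>

definition CH :: "config \<Rightarrow> point set" where
  "CH P = convex hull (set_mset P)"

definition centroid :: "config \<Rightarrow> point" where
  "centroid P = (1 / real (size P)) *\<^sub>R (\<Sum>x\<in>#P. x)"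

definition scaled_CH :: "real \<Rightarrow> config \<Rightarrow> point set" where
  "scaled_CH d P = {d *\<^sub>R x + (1 - d) *\<^sub>R centroid P | x. x \<in> CH P}"

text \<open>The infimum of the empty set in \<^typ>\<open>ereal\<close> is \<^term>\<open>\<infinity>\<close>; whenever the set is nonempty, the
  infimum is a minimum (see \<open>target_scale_at_attained\<close> below).\<close>

definition target_scale_at :: "target \<Rightarrow> config \<Rightarrow> ereal" where
  "target_scale_at \<phi> P =
     (case \<phi> P of
        None \<Rightarrow> 0
      | Some p \<Rightarrow> Inf {ereal d | d. 0 \<le> d \<and> p \<in> scaled_CH d P})"

definition target_scale :: "target \<Rightarrow> ereal" where
  "target_scale \<phi> = (SUP P\<in>{P. P \<noteq> {#}}. target_scale_at \<phi> P)"

definition target_set_scale :: "target set \<Rightarrow> ereal" where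
  "target_set_scale \<Phi> = (SUP \<phi>\<in>\<Phi>. target_scale \<phi>)"

lemma scaled_CH_least:
  assumes "0 \<le> d" "p \<in> scaled_CH d P"
  obtains m where "0 \<le> m" "p \<in> scaled_CH m P"
    "\<And>e. 0 \<le> e \<Longrightarrow> p \<in> scaled_CH e P \<Longrightarrow> m \<le> e"
proof -
  define K where "K = {z \<in> {0..d} \<times> CH P. fst z *\<^sub>R snd z + (1 - fst z) *\<^sub>R centroid P = p}"
  have K: "e \<in> fst ` K \<longleftrightarrow> 0 \<le> e \<and> e \<le> d \<and> p \<in> scaled_CH e P" for e
  proof
    assume "e \<in> fst ` K"
    then obtain x where "(e, x) \<in> K"
      by auto
    then show "0 \<le> e \<and> e \<le> d \<and> p \<in> scaled_CH e P"
      unfolding K_def scaled_CH_def by auto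
  next
    assume e: "0 \<le> e \<and> e \<le> d \<and> p \<in> scaled_CH e P"
    then obtain x where "x \<in> CH P" "p = e *\<^sub>R x + (1 - e) *\<^sub>R centroid P"
      unfolding scaled_CH_def by auto
    with e have "(e, x) \<in> K"
      unfolding K_def by simp
    then show "e \<in> fst ` K"
      by (metis fst_conv image_eqI)
  qed
  have "compact (CH P)"
    unfolding CH_def by (intro finite_imp_compact_convex_hull) auto
  then have c: "compact ({0..d} \<times> CH P)"
    by (intro compact_Times) auto
  have "closed {z. fst z *\<^sub>R snd z + (1 - fst z) *\<^sub>R centroid P = p}"
    by (intro closed_Collect_eq continuous_intros)
  then have "compact (({0..d} \<times> CH P) \<inter> {z. fst z *\<^sub>R snd z + (1 - fst z) *\<^sub>R centroid P = p})"
    by (rule compact_Int_closed[OF c])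
  also have "({0..d} \<times> CH P) \<inter> {z. fst z *\<^sub>R snd z + (1 - fst z) *\<^sub>R centroid P = p} = K"
    unfolding K_def by blast
  finally have "compact K" .
  then have "compact (fst ` K)"
    by (intro compact_continuous_image continuous_intros)
  moreover have "d \<in> fst ` K"
    using assms K by auto
  ultimately obtain m where m: "m \<in> fst ` K" "\<And>e. e \<in> fst ` K \<Longrightarrow> m \<le> e"
    using compact_attains_inf[of "fst ` K"] by blast
  show ?thesis
  proof (rule that[of m])
    show "0 \<le> m" "p \<in> scaled_CH m P"
      using m(1) K by auto
    show "m \<le> e" if "0 \<le> e" "p \<in> scaled_CH e P" for e
      using that m K[of e] K[of m] by (cases "e \<le> d") auto
  qed
qed

lemma target_scale_at_attained:
  assumes "\<phi> P = Some p" "0 \<le> d" "p \<in> scaled_CH d P"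
  obtains m where "0 \<le> m" "p \<in> scaled_CH m P" "target_scale_at \<phi> P = ereal m"
    "\<And>e. 0 \<le> e \<Longrightarrow> p \<in> scaled_CH e P \<Longrightarrow> m \<le> e"
proof -
  obtain m where m: "0 \<le> m" "p \<in> scaled_CH m P"
    "\<And>e. 0 \<le> e \<Longrightarrow> p \<in> scaled_CH e P \<Longrightarrow> m \<le> e"
    using scaled_CH_least[OF assms(2,3)] by blast
  have "Inf {ereal d | d. 0 \<le> d \<and> p \<in> scaled_CH d P} = ereal m"
  proof (rule Inf_eqI)
    show "ereal m \<le> i" if "i \<in> {ereal d | d. 0 \<le> d \<and> p \<in> scaled_CH d P}" for i
      using that m(3) by auto
    show "y \<le> ereal m"
      if "\<And>i. i \<in> {ereal d | d. 0 \<le> d \<and> p \<in> scaled_CH d P} \<Longrightarrow> y \<le> i" for y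
      by (rule that) (use m(1,2) in blast)
  qed
  with m show ?thesis
    using that assms(1) by (simp add: target_scale_at_def)
qed


subsection \<open>Robots\<close>

text \<open>A local coordinate system is given by its linear part: the unit length \<open>c\<close> and the rotation \<open>R\<close>
  that takes the global axis directions to the local ones. Its origin is the current position of
  the robot.\<close>

definition local_frame :: "(point \<Rightarrow> point) \<Rightarrow> bool" where
  "local_frame L \<longleftrightarrow>
     (\<exists>c R. c > 0 \<and> orthogonal_transformation R \<and> det (matrix R) = 1 \<and> L = (\<lambda>v. c *\<^sub>R R v))"

definition to_global :: "(point \<Rightarrow> point) \<Rightarrow> point \<Rightarrow> point \<Rightarrow> point" where
  "to_global L x v = x + L v"

text \<open>The robots are \<open>1, \<dots>, n\<close>, and \<open>x t i\<close> is the position of robot \<open>i\<close> at time \<open>t\<close>.\<close>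

definition config_at :: "nat \<Rightarrow> (nat \<Rightarrow> nat \<Rightarrow> point) \<Rightarrow> nat \<Rightarrow> config" where
  "config_at n x t = image_mset (x t) (mset_set {1..n})"

definition fair_schedule :: "nat \<Rightarrow> (nat \<Rightarrow> nat set) \<Rightarrow> bool" where
  "fair_schedule n A \<longleftrightarrow>
     (\<forall>t. A t \<subseteq> {1..n}) \<and> (\<forall>i\<in>{1..n}. infinite {t. i \<in> A t})"

text \<open>\<open>crash i\<close> is the time at which robot \<open>i\<close> crashes, \<open>\<infinity>\<close> if it never does. Robot \<open>i\<close> is crashed
  from time \<open>crash i\<close> on, so it makes no move from time \<open>t\<close> to \<open>t + 1\<close> if \<open>crash i \<le> t\<close>.\<close>

definition faulty :: "nat \<Rightarrow> (nat \<Rightarrow> enat) \<Rightarrow> nat set" where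
  "faulty n crash = {i \<in> {1..n}. crash i \<noteq> \<infinity>}"

text \<open>Whenever \<^term>\<open>the\<close> is used below, the observed multiset contains the origin (the position
  of the observing robot), hence the target is not \<^term>\<open>None\<close>.\<close>

definition execution ::
  "nat \<Rightarrow> (nat \<Rightarrow> target) \<Rightarrow> (nat \<Rightarrow> point \<Rightarrow> point) \<Rightarrow> (nat \<Rightarrow> nat set) \<Rightarrow> (nat \<Rightarrow> enat)
    \<Rightarrow> (nat \<Rightarrow> nat \<Rightarrow> point) \<Rightarrow> bool" where
  "execution n \<phi> L A crash x \<longleftrightarrow>
     (\<forall>t. \<forall>i\<in>{1..n}.
        x (Suc t) i =
          (if i \<in> A t \<and> enat t < crash i
           then let \<gamma> = to_global (L i) (x t i)
                in \<gamma> (the (\<phi> i (image_mset (inv \<gamma>) (config_at n x t))))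
           else x t i))"

definition converges_to_points :: "nat \<Rightarrow> nat \<Rightarrow> (nat \<Rightarrow> nat \<Rightarrow> point) \<Rightarrow> bool" where
  "converges_to_points n f x \<longleftrightarrow>
     (\<exists>S. finite S \<and> card S \<le> f \<and> (\<forall>i\<in>{1..n}. \<exists>p\<in>S. (\<lambda>t. x t i) \<longlonglongrightarrow> p))"

text \<open>The initial configuration \<open>x 0\<close> of an execution is arbitrary.\<close>

definition FC_PO_compatible :: "nat \<Rightarrow> target set \<Rightarrow> bool" where
  "FC_PO_compatible f \<Phi> \<longleftrightarrow>
     (\<forall>n \<phi> L A crash x.
        n \<ge> f + 1 \<and> (\<forall>i\<in>{1..n}. \<phi> i \<in> \<Phi>) \<and> (\<forall>i\<in>{1..n}. local_frame (L i)) \<and>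
        fair_schedule n A \<and> card (faulty n crash) \<le> f \<and> execution n \<phi> L A crash x
        \<longrightarrow> converges_to_points n f x)"

definition FC_PO_algorithm :: "nat \<Rightarrow> target \<Rightarrow> bool" where
  "FC_PO_algorithm f \<phi> \<longleftrightarrow> FC_PO_compatible f {\<phi>}"

end

theory Submission
  imports Defs
begin

text \<open>Crash \<open>f\<close> robots at distinct points \<open>q\<^sub>1, \<dots>, q\<^sub>f\<close> of a parabola and let a single correct robot
  run. The crashed robots occupy \<open>f\<close> points, so the correct one would have to converge to some \<open>q\<^sub>j\<close>.
  Since \<open>q\<^sub>j\<close> is an exposed point of the hull, while the centroid stays away from it because
  \<open>f \<ge> 2\<close>, a target of scale below \<open>1\<close> stays at a positive distance from \<open>q\<^sub>j\<close> as the robot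
  approaches \<open>q\<^sub>j\<close>.\<close>

lemma inner_sum_mset: "w \<bullet> sum_mset P = (\<Sum>v\<in>#P. w \<bullet> v)"
  by (induction P) (auto simp: inner_add_right)

lemma inner_centroid_ge:
  assumes "P \<noteq> {#}" "\<And>v. v \<in># P \<Longrightarrow> m \<le> w \<bullet> v"
  shows "m \<le> w \<bullet> centroid P"
proof -
  have "real (size P) * m \<le> (\<Sum>v\<in>#P. w \<bullet> v)"
    using assms(2) by (induction P) (auto simp: algebra_simps add_mono)
  moreover have "real (size P) > 0"
    using assms(1) by (simp add: nonempty_has_size)
  ultimately show ?thesis
    by (simp add: centroid_def inner_sum_mset field_simps)
qed

lemma inner_CH_ge:
  assumes "y \<in> CH P" "\<And>v. v \<in># P \<Longrightarrow> m \<le> w \<bullet> v"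
  shows "m \<le> w \<bullet> y"
proof -
  have "convex hull (set_mset P) \<subseteq> {v. w \<bullet> v \<ge> m}"
    using assms(2) by (intro hull_minimal convex_halfspace_ge) auto
  then show ?thesis
    using assms(1) by (auto simp: CH_def)
qed

text \<open>Hull points and the centroid both have \<open>w\<close>-value at least \<open>m\<close>,
  so replacing the weight \<open>d\<close> by the larger \<open>D\<close> only shifts weight from
  the centroid towards the lower value \<open>m\<close>. This makes the bound uniform in
  \<open>d\<close>.\<close>

lemma inner_scaled_CH_ge:
  assumes "p \<in> scaled_CH d P" "0 \<le> d" "d \<le> D" "P \<noteq> {#}" "\<And>v. v \<in># P \<Longrightarrow> m \<le> w \<bullet> v"
  shows "D * m + (1 - D) * (w \<bullet> centroid P) \<le> w \<bullet> p"
proof -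
  obtain y where y: "y \<in> CH P" "p = d *\<^sub>R y + (1 - d) *\<^sub>R centroid P"
    using assms(1) by (auto simp: scaled_CH_def)
  have "(D - d) * m \<le> (D - d) * (w \<bullet> centroid P)"
    using inner_centroid_ge[OF assms(4,5)] assms(3) by (intro mult_left_mono) auto
  moreover have "d * m \<le> d * (w \<bullet> y)"
    using inner_CH_ge[OF y(1) assms(5)] assms(2) by (intro mult_left_mono) auto
  ultimately show ?thesis
    by (simp add: y(2) inner_add_right algebra_simps)
qed

lemma target_in_scaled_CH:
  assumes "target_scale \<phi> < ereal D" "P \<noteq> {#}" "\<phi> P = Some p"
  obtains d where "0 \<le> d" "d < D" "p \<in> scaled_CH d P"
proof -
  have "target_scale_at \<phi> P \<le> target_scale \<phi>"
    unfolding target_scale_def using assms(2) by (intro SUP_upper) auto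
  with assms have "Inf {ereal d | d. 0 \<le> d \<and> p \<in> scaled_CH d P} < ereal D"
    by (simp add: target_scale_at_def)
  then show ?thesis
    using that by (auto simp: Inf_less_iff)
qed

definition parabola :: "nat \<Rightarrow> point" where
  "parabola i = vector [real i, (real i)\<^sup>2]"

text \<open>Normal of the tangent at \<open>parabola j\<close>, pointing to the convex side of the
  curve.\<close>

definition parabola_normal :: "nat \<Rightarrow> point" where
  "parabola_normal j = vector [- 2 * real j, 1]"

text \<open>The square is the height of \<open>parabola i\<close> above the tangent at
  \<open>parabola j\<close>. It vanishes only for \<open>i = j\<close>, so each of these points is
  exposed.\<close>

lemma inner_parabola_diff:
  "parabola_normal j \<bullet> (parabola i - parabola j) = (real i - real j)\<^sup>2"
  by (simp add: parabola_def parabola_normal_def inner_vec_def sum_2 power2_eq_square algebra_simps)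

lemma inj_parabola: "inj parabola"
proof (rule injI)
  fix i j assume "parabola i = parabola j"
  then have "(real i - real j)\<^sup>2 = 0"
    using inner_parabola_diff[of j i] by simp
  then show "i = j" by simp
qed

text \<open>The view of the correct robot from \<open>z\<close> in a frame with global axes and unit
  length; the added \<open>0\<close> is the robot itself.\<close>

definition observed :: "nat \<Rightarrow> point \<Rightarrow> config" where
  "observed f z = add_mset 0 (image_mset (\<lambda>i. parabola i - z) (mset_set {1..f}))"

fun correct_robot :: "nat \<Rightarrow> target \<Rightarrow> nat \<Rightarrow> point" where
  "correct_robot f \<phi> 0 = 0" |
  "correct_robot f \<phi> (Suc t) =
     correct_robot f \<phi> t + the (\<phi> (observed f (correct_robot f \<phi> t)))"

definition positions :: "nat \<Rightarrow> target \<Rightarrow> nat \<Rightarrow> nat \<Rightarrow> point" where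
  "positions f \<phi> t i = (if i \<le> f then parabola i else correct_robot f \<phi> t)"

lemma observed_config_at:
  "image_mset (\<lambda>v. v - correct_robot f \<phi> t) (config_at (Suc f) (positions f \<phi>) t)
     = observed f (correct_robot f \<phi> t)"
proof -
  have "mset_set {1..Suc f} = add_mset (Suc f) (mset_set {1..f})"
    by (simp add: atLeastAtMostSuc_conv)
  moreover have "image_mset (\<lambda>i. positions f \<phi> t i - correct_robot f \<phi> t) (mset_set {1..f})
      = image_mset (\<lambda>i. parabola i - correct_robot f \<phi> t) (mset_set {1..f})"
    by (intro image_mset_cong) (auto simp: positions_def)
  ultimately show ?thesis
    by (simp add: config_at_def observed_def multiset.map_comp comp_def positions_def)
qed

lemma local_frame_id: "local_frame (\<lambda>v. v)"
  unfolding local_frame_def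
  by (intro exI[of _ 1] exI[of _ "\<lambda>v. v"])
    (auto simp: orthogonal_transformation_id matrix_id_mat_1[unfolded id_def])

lemma execution_positions:
  "execution (Suc f) (\<lambda>_. \<phi>) (\<lambda>_ v. v) (\<lambda>_. {1..Suc f}) (\<lambda>i. if i \<le> f then 0 else \<infinity>)
     (positions f \<phi>)"
proof -
  have "inv (to_global (\<lambda>v. v) a) = (\<lambda>v. v - a)" for a
    by (rule inv_unique_comp) (auto simp: to_global_def fun_eq_iff)
  moreover have "positions f \<phi> t i = correct_robot f \<phi> t" if "\<not> i \<le> f" for t i
    using that by (simp add: positions_def)
  ultimately show ?thesis
    unfolding execution_def Let_def
    \<comment> \<open>The inverse frame and the view must be rewritten first, while
      \<open>to_global\<close> and \<open>positions\<close> are still folded.\<close>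
    by (auto simp: observed_config_at) (auto simp: to_global_def positions_def zero_enat_def)
qed

text \<open>The move is the target itself, as the frame is the identity. The \<open>min\<close> is
  the least \<open>w\<close>-value in view: \<open>0\<close> for the robot itself, and the value at
  index \<open>j\<close> for the crashed ones. In the centroid the robot adds nothing to the sum but
  counts in the size \<open>Suc f\<close>.\<close>

lemma correct_robot_step:
  fixes f j t :: nat
  assumes "target_function \<phi>" "target_scale \<phi> < ereal D"
  defines "z \<equiv> correct_robot f \<phi>" and "w \<equiv> parabola_normal j"
  shows "D * min 0 (w \<bullet> (parabola j - z t))
           + (1 - D) * ((\<Sum>i=1..f. w \<bullet> (parabola i - z t)) / real (Suc f))
         \<le> w \<bullet> (z (Suc t) - z t)"
proof -
  let ?P = "observed f (z t)"
  have "?P \<noteq> {#}" "0 \<in># ?P"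
    by (auto simp: observed_def)
  with assms(1) obtain p where p: "\<phi> ?P = Some p"
    unfolding target_function_def by blast
  then obtain d where d: "0 \<le> d" "d < D" "p \<in> scaled_CH d ?P"
    using target_in_scaled_CH[OF assms(2) \<open>?P \<noteq> {#}\<close>] by blast
  have "min 0 (w \<bullet> (parabola j - z t)) \<le> w \<bullet> v" if "v \<in># ?P" for v
  proof -
    \<comment> \<open>No point of the parabola lies below its tangent at index
      \<open>j\<close>.\<close>
    have "w \<bullet> (parabola j - z t) \<le> w \<bullet> (parabola i - z t)" for i
      using inner_parabola_diff[of j i] by (simp add: w_def inner_diff_right)
        (smt (verit) zero_le_power2)
    with that show ?thesis
      by (auto simp: observed_def min_le_iff_disj)
  qed
  moreover have "w \<bullet> centroid ?P = (\<Sum>i=1..f. w \<bullet> (parabola i - z t)) / real (Suc f)"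
    by (simp add: centroid_def observed_def sum_unfold_sum_mset multiset.map_comp comp_def
        inner_sum_mset)
  ultimately have "D * min 0 (w \<bullet> (parabola j - z t))
           + (1 - D) * ((\<Sum>i=1..f. w \<bullet> (parabola i - z t)) / real (Suc f)) \<le> w \<bullet> p"
    using inner_scaled_CH_ge[OF d(3,1) less_imp_le[OF d(2)] \<open>?P \<noteq> {#}\<close>] by metis
  moreover have "z (Suc t) - z t = p"
    using p by (simp add: z_def)
  ultimately show ?thesis
    by simp
qed

text \<open>Convergence forces the moves to tend to \<open>0\<close>, but near
  \<open>parabola j\<close> the hull term of their lower bound vanishes and the centroid term keeps
  a positive limit.\<close>

lemma correct_robot_not_tendsto:
  assumes "target_function \<phi>" "target_scale \<phi> < 1" "f \<ge> 2"
  shows "\<not> correct_robot f \<phi> \<longlonglongrightarrow> parabola j"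
proof
  let ?z = "correct_robot f \<phi>" and ?w = "parabola_normal j"
  assume z: "?z \<longlonglongrightarrow> parabola j"
  \<comment> \<open>A real number strictly between the scale and 1 keeps the centroid weight
    \<open>1 - D\<close> positive.\<close>
  obtain D where D: "target_scale \<phi> < ereal D" "D < 1"
    using ereal_dense2[OF assms(2)] by auto
  have "(\<lambda>t. D * min 0 (?w \<bullet> (parabola j - ?z t))
           + (1 - D) * ((\<Sum>i=1..f. ?w \<bullet> (parabola i - ?z t)) / real (Suc f)))
      \<longlonglongrightarrow> D * min 0 (?w \<bullet> (parabola j - parabola j))
           + (1 - D) * ((\<Sum>i=1..f. ?w \<bullet> (parabola i - parabola j)) / real (Suc f))"
    by (intro tendsto_intros z) auto
  moreover have "(\<lambda>t. ?w \<bullet> (?z (Suc t) - ?z t)) \<longlonglongrightarrow> ?w \<bullet> (parabola j - parabola j)"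
    by (intro tendsto_intros z LIMSEQ_Suc)
  ultimately have "(1 - D) * ((\<Sum>i=1..f. (real i - real j)\<^sup>2) / real (Suc f)) \<le> 0"
    using LIMSEQ_le correct_robot_step[OF assms(1) D(1)]
    by (fastforce simp: inner_parabola_diff simp del: correct_robot.simps)
  moreover have "(\<Sum>i=1..f. (real i - real j)\<^sup>2) > 0"
  \<comment> \<open>The witness is an index other than \<open>j\<close>; index 2 is available
    because \<open>f \<ge> 2\<close>.\<close>
  proof (rule sum_pos2[of _ "if j = 1 then 2 else 1"])
    show "(if j = 1 then 2 else 1) \<in> {1..f}"
      using assms(3) by auto
  qed auto
  ultimately show False
    using D(2) by (simp add: mult_le_0_iff divide_le_0_iff)
qed

lemma not_FC_PO_compatible:
  assumes "f \<ge> 2" "\<phi> \<in> \<Phi>" "target_function \<phi>" "target_scale \<phi> < 1"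
  shows "\<not> FC_PO_compatible f \<Phi>"
proof
  let ?crash = "\<lambda>i::nat. if i \<le> f then 0 else \<infinity> :: enat"
  assume "FC_PO_compatible f \<Phi>"
  \<comment> \<open>Every robot is activated in every round; robots 1 to \<open>f\<close> are
    crashed from time 0 and stay put.\<close>
  moreover have "fair_schedule (Suc f) (\<lambda>_. {1..Suc f})"
    by (auto simp: fair_schedule_def)
  moreover have "faulty (Suc f) ?crash = {1..f}"
    by (auto simp: faulty_def zero_enat_def)
  ultimately have "converges_to_points (Suc f) f (positions f \<phi>)"
    using assms(2) local_frame_id execution_positions[of f \<phi>]
    unfolding FC_PO_compatible_def by (metis Suc_eq_plus1 card_atLeastAtMost diff_Suc_1 order_refl)
  then obtain S where S: "finite S" "card S \<le> f"
    "\<And>i. i \<in> {1..Suc f} \<Longrightarrow> \<exists>p\<in>S. (\<lambda>t. positions f \<phi> t i) \<longlonglongrightarrow> p"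
    unfolding converges_to_points_def by blast
  \<comment> \<open>A crashed robot is a constant sequence, so its limit is its own position. These
    \<open>f\<close> distinct points exhaust \<open>S\<close>, leaving no other limit for the
    correct robot.\<close>
  have "parabola i \<in> S" if "i \<in> {1..f}" for i
    using S(3)[of i] that by (auto simp: positions_def LIMSEQ_const_iff)
  then have "parabola ` {1..f} \<subseteq> S"
    by blast
  moreover have "card (parabola ` {1..f}) = f"
    using inj_parabola by (simp add: card_image inj_on_subset)
  ultimately have "S = parabola ` {1..f}"
    using S(1,2) by (metis card_seteq)
  with S(3)[of "Suc f"] obtain j where "correct_robot f \<phi> \<longlonglongrightarrow> parabola j"
    by (auto simp: positions_def)
  with correct_robot_not_tendsto assms show False
    by blast
qed

theorem theorem10:
  fixes f :: nat
  assumes "f \<ge> 2"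
  shows "(\<forall>\<phi>. target_function \<phi> \<and> 0 \<le> target_scale \<phi> \<and> target_scale \<phi> < 1 \<longrightarrow> \<not> FC_PO_algorithm f \<phi>) \<and>
         (\<forall>\<Phi>. \<Phi> \<noteq> {} \<and> (\<forall>\<phi>\<in>\<Phi>. target_function \<phi>) \<and> 0 \<le> target_set_scale \<Phi> \<and> target_set_scale \<Phi> < 1
               \<longrightarrow> \<not> FC_PO_compatible f \<Phi>)"
proof (intro conjI allI impI)
  fix \<phi> assume "target_function \<phi> \<and> 0 \<le> target_scale \<phi> \<and> target_scale \<phi> < 1"
  then show "\<not> FC_PO_algorithm f \<phi>"
    using not_FC_PO_compatible[OF assms] by (simp add: FC_PO_algorithm_def)
next
  fix \<Phi> assume \<Phi>: "\<Phi> \<noteq> {} \<and> (\<forall>\<phi>\<in>\<Phi>. target_function \<phi>) \<and> 0 \<le> target_set_scale \<Phi> \<and> target_set_scale \<Phi> < 1"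
  \<comment> \<open>Any single member refutes compatibility, since all robots may be assigned the
    same function.\<close>
  then obtain \<phi> where "\<phi> \<in> \<Phi>"
    by blast
  moreover from this have "target_scale \<phi> \<le> target_set_scale \<Phi>"
    unfolding target_set_scale_def by (rule SUP_upper)
  ultimately show "\<not> FC_PO_compatible f \<Phi>"
    using not_FC_PO_compatible[OF assms] \<Phi> by (meson le_less_trans)
qed

end
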